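(* Every regainingly approximable real number is superspeedable.
   Context: A real $x$ is regainingly approximable if there is a computable increasing sequence of rationals $(x_n)_n$ converging to $x$ with $x-x_n\le 2^{-n}$ for infinitely many $n$. A left-approximation of $x$ is a computable increasing sequence $(x_n)_n$ of rationals converging to $x$; $x$ is superspeedable if it has a left-approximation with $\limsup_{n\to\infty}\frac{x_{n+1}-x_n}{x-x_n}=1$. *)

theory Defs
  imports Complex_Main "HOL-Library.Extended_Real"
begin

datatype recf =
    Zero
  | Succ
  | Proj nat
  | Comp recf "recf list"
  | Prec recf recf
  | Mu recf

text \<open>
  Big-step semantics of Kleene's partial mu-recursive functions: \<open>rec_eval r xs y\<close> says that
  \<open>r\<close> halts on input \<open>xs\<close> with output \<open>y\<close>. The recursion argument of \<open>Prec\<close> and the search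
  argument of \<open>Mu\<close> come first, and the step function of \<open>Prec\<close> takes the counter, the previous
  value and the parameters, in this order.
\<close>

inductive rec_eval :: "recf \<Rightarrow> nat list \<Rightarrow> nat \<Rightarrow> bool" where
  zero: "rec_eval Zero xs 0"
| succ: "rec_eval Succ [x] (Suc x)"
| proj: "i < length xs \<Longrightarrow> rec_eval (Proj i) xs (xs ! i)"
| comp: "list_all2 (\<lambda>g y. rec_eval g xs y) gs ys \<Longrightarrow> rec_eval f ys z
           \<Longrightarrow> rec_eval (Comp f gs) xs z"
| prec_0: "rec_eval f xs y \<Longrightarrow> rec_eval (Prec f g) (0 # xs) y"
| prec_Suc: "rec_eval (Prec f g) (n # xs) y \<Longrightarrow> rec_eval g (n # y # xs) z
           \<Longrightarrow> rec_eval (Prec f g) (Suc n # xs) z"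
| mu: "rec_eval f (n # xs) 0 \<Longrightarrow> (\<forall>m<n. \<exists>y. rec_eval f (m # xs) (Suc y))
           \<Longrightarrow> rec_eval (Mu f) xs n"

lemma rec_eval_deterministic:
  "rec_eval r xs y \<Longrightarrow> rec_eval r xs z \<Longrightarrow> y = z"
proof (induction arbitrary: z rule: rec_eval.induct)
  case (zero xs)
  then show ?case by (auto elim: rec_eval.cases)
next
  case (succ x)
  then show ?case by (auto elim: rec_eval.cases)
next
  case (proj i xs)
  from proj(2) show ?case by (auto elim: rec_eval.cases)
next
  case (comp xs gs ys f w)
  from comp.prems obtain ys' where ys': "list_all2 (\<lambda>g y. rec_eval g xs y) gs ys'" "rec_eval f ys' z"
    by (auto elim: rec_eval.cases)
  have "ys = ys'"
    using comp.IH(1) ys'(1) by (auto simp: list_all2_conv_all_nth intro: nth_equalityI)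
  with comp.IH(2) ys'(2) show ?case by blast
next
  case (prec_0 f xs y g)
  from prec_0.prems have "rec_eval f xs z" by (auto elim: rec_eval.cases)
  with prec_0.IH show ?case by blast
next
  case (prec_Suc f g n xs y w)
  from prec_Suc.prems obtain y' where "rec_eval (Prec f g) (n # xs) y'" "rec_eval g (n # y' # xs) z"
    by (auto elim: rec_eval.cases)
  with prec_Suc.IH show ?case by blast
next
  case (mu f n xs)
  from mu.prems have z: "rec_eval f (z # xs) 0" "\<forall>m<z. \<exists>y. rec_eval f (m # xs) (Suc y)"
    by (auto elim: rec_eval.cases)
  have "\<not> z < n" using mu.IH(2) z(1) by fastforce
  moreover have "\<not> n < z" using mu.IH(1) z(2) by fastforce
  ultimately show ?case by simp
qed

definition computable :: "(nat \<Rightarrow> nat) \<Rightarrow> bool" where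
  "computable f \<longleftrightarrow> (\<exists>r. \<forall>n. rec_eval r [n] (f n))"

text \<open>
  A computable sequence of rationals is one given by computable sequences of signs,
  numerators and denominators.
\<close>

definition computable_rat_seq :: "(nat \<Rightarrow> rat) \<Rightarrow> bool" where
  "computable_rat_seq q \<longleftrightarrow>
     (\<exists>s a b. computable s \<and> computable a \<and> computable b \<and>
        (\<forall>n. b n \<noteq> 0 \<and> q n = (-1) ^ s n * (of_nat (a n) / of_nat (b n))))"

text \<open>
  \<open>Increasing\<close> is read strictly, so that every member of a left-approximation is below the limit
  and the quotients in \<open>superspeedable\<close> have nonzero denominators.
\<close>

definition left_approximation :: "(nat \<Rightarrow> rat) \<Rightarrow> real \<Rightarrow> bool" where
  "left_approximation q x \<longleftrightarrow>
     computable_rat_seq q \<and> strict_mono q \<and> (\<lambda>n. real_of_rat (q n)) \<longlonglongrightarrow> x"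

definition regainingly_approximable :: "real \<Rightarrow> bool" where
  "regainingly_approximable x \<longleftrightarrow>
     (\<exists>q. left_approximation q x \<and> infinite {n. x - real_of_rat (q n) \<le> 1 / 2 ^ n})"

definition superspeedable :: "real \<Rightarrow> bool" where
  "superspeedable x \<longleftrightarrow>
     (\<exists>q. left_approximation q x \<and>
        limsup (\<lambda>n. ereal ((real_of_rat (q (Suc n)) - real_of_rat (q n)) / (x - real_of_rat (q n)))) = 1)"

end

theory Submission
  imports Defs "HOL-Real_Asymp.Real_Asymp"
begin

text \<open>
  If the quotients of a left-approximation \<open>q\<close> of \<open>x\<close> stay below some \<open>L < 1\<close>, then each step
  shrinks the error \<open>x - q n\<close> at most by the factor \<open>1 - L\<close>, so the error decays at most
  exponentially. Passing from a regaining approximation \<open>q\<close> to the subsequence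
  \<open>\<lambda>n. q (2 ^ n)\<close> makes the error doubly exponentially small infinitely often: a regaining index
  \<open>m\<close> with \<open>2 ^ k \<le> m < 2 ^ Suc k\<close> yields \<open>x - q (2 ^ Suc k) \<le> 1 / 2 ^ m \<le> 1 / 2 ^ 2 ^ k\<close>.
  Hence the quotients of the subsequence have limes superior \<open>1\<close>.
\<close>

lemma computable_compose:
  assumes "computable f" "computable g"
  shows "computable (\<lambda>n. f (g n))"
proof -
  from assms obtain r s where "\<And>n. rec_eval r [n] (f n)" "\<And>n. rec_eval s [n] (g n)"
    unfolding computable_def by blast
  then have "rec_eval (Comp r [s]) [n] (f (g n))" for n
    by (intro rec_eval.comp[where ys = "[g n]"]) auto
  then show ?thesis
    unfolding computable_def by blast
qed

lemma computable_rat_seq_compose: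
  assumes "computable_rat_seq q" "computable g"
  shows "computable_rat_seq (\<lambda>n. q (g n))"
proof -
  from assms(1) obtain s a b where "computable s" "computable a" "computable b"
    and "\<And>n. b n \<noteq> 0 \<and> q n = (-1) ^ s n * (of_nat (a n) / of_nat (b n))"
    unfolding computable_rat_seq_def by blast
  with assms(2) show ?thesis
    unfolding computable_rat_seq_def
    by (intro exI[of _ "\<lambda>n. s (g n)"] exI[of _ "\<lambda>n. a (g n)"] exI[of _ "\<lambda>n. b (g n)"])
      (simp add: computable_compose)
qed

definition rec_add :: recf where
  "rec_add = Prec (Proj 0) (Comp Succ [Proj 1])"

definition rec_pow2 :: recf where
  "rec_pow2 = Prec (Comp Succ [Zero]) (Comp rec_add [Proj 1, Proj 1])"

lemma rec_eval_proj: "i < length xs \<Longrightarrow> y = xs ! i \<Longrightarrow> rec_eval (Proj i) xs y"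
  using rec_eval.proj by simp

lemma rec_eval_rec_add: "rec_eval rec_add [m, n] (m + n)"
proof (induction m)
  case 0
  show ?case
    unfolding rec_add_def by (auto intro!: rec_eval.prec_0 rec_eval_proj)
next
  case (Suc m)
  have "rec_eval (Comp Succ [Proj 1]) [m, m + n, n] (Suc (m + n))"
    by (rule rec_eval.comp[where ys = "[m + n]"]) (auto intro: rec_eval.succ rec_eval_proj)
  with Suc show ?case
    unfolding rec_add_def by (auto intro: rec_eval.prec_Suc)
qed

lemma rec_eval_rec_pow2: "rec_eval rec_pow2 [n] (2 ^ n)"
proof (induction n)
  case 0
  \<comment> \<open>\<open>rec_pow2\<close> is unary, so its base case runs on the empty parameter
    list, which \<open>Zero\<close> accepts.\<close>
  have "rec_eval (Comp Succ [Zero]) [] (Suc 0)"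
    by (rule rec_eval.comp[where ys = "[0]"]) (auto intro: rec_eval.succ rec_eval.zero)
  then show ?case
    unfolding rec_pow2_def by (auto intro: rec_eval.prec_0)
next
  case (Suc n)
  have "rec_eval (Comp rec_add [Proj 1, Proj 1]) [n, 2 ^ n] (2 ^ n + 2 ^ n)"
    by (rule rec_eval.comp[where ys = "[2 ^ n, 2 ^ n]"])
      (auto intro: rec_eval_rec_add rec_eval_proj)
  with Suc show ?case
    unfolding rec_pow2_def by (auto intro: rec_eval.prec_Suc simp: mult_2)
qed

lemma computable_pow2: "computable (\<lambda>n. 2 ^ n)"
  using rec_eval_rec_pow2 unfolding computable_def by blast

text \<open>Strictness of the sequence matters here: one further step is strictly larger and still
  at most the limit. This keeps all errors positive.\<close>

lemma left_approximation_less: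
  assumes "left_approximation q x"
  shows "real_of_rat (q n) < x"
proof -
  have "real_of_rat (q n) < real_of_rat (q (Suc n))"
    using assms by (simp add: left_approximation_def strict_mono_def of_rat_less)
  also have "\<dots> \<le> x"
    using assms
    by (intro incseq_le) (auto simp: left_approximation_def strict_mono_less_eq of_rat_less_eq mono_def)
  finally show ?thesis .
qed

lemma left_approximation_subseq:
  assumes "left_approximation q x" "computable g" "strict_mono g"
  shows "left_approximation (\<lambda>n. q (g n)) x"
proof -
  have "(\<lambda>n. real_of_rat (q (g n))) \<longlonglongrightarrow> x"
    using LIMSEQ_subseq_LIMSEQ[OF _ assms(3)] assms(1)
    unfolding left_approximation_def comp_def by blast
  with assms show ?thesis
    by (auto simp: left_approximation_def strict_mono_def computable_rat_seq_compose)
qed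

text \<open>Iterate the inequality from the index \<open>N\<close> at which it starts to hold;
  dividing \<open>e N\<close> by \<open>c ^ N\<close> makes the bound exact at
  \<open>N\<close>.\<close>

lemma geometric_lower_bound:
  fixes e :: "nat \<Rightarrow> real"
  assumes "\<And>n. e n > 0" "c > 0" "eventually (\<lambda>n. c * e n \<le> e (Suc n)) sequentially"
  obtains C where "C > 0" "eventually (\<lambda>n. C * c ^ n \<le> e n) sequentially"
proof -
  from assms(3) obtain N where N: "\<And>n. n \<ge> N \<Longrightarrow> c * e n \<le> e (Suc n)"
    unfolding eventually_sequentially by blast
  have "e N / c ^ N * c ^ n \<le> e n" if "n \<ge> N" for n
    using that
  proof (induction n rule: dec_induct)
    case base
    then show ?case using assms(2) by simp
  next
    case (step n)
    have "e N / c ^ N * c ^ Suc n = c * (e N / c ^ N * c ^ n)" by simp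
    also have "\<dots> \<le> c * e n" using step.IH assms(2) by (intro mult_left_mono) auto
    also have "\<dots> \<le> e (Suc n)" using N step.hyps by simp
    finally show ?case .
  qed
  then show ?thesis
    using that[of "e N / c ^ N"] assms(1,2) unfolding eventually_sequentially by auto
qed

text \<open>After taking logarithms, \<open>2 ^ n\<close> outgrows every linear function of
  \<open>n\<close>.\<close>

lemma doubly_exponential_less_geometric:
  fixes c C :: real
  assumes "c > 0" "C > 0"
  shows "eventually (\<lambda>n. 1 / 2 ^ 2 ^ n < C * c ^ Suc n) sequentially"
proof -
  have "eventually (\<lambda>n::nat. 1 / 2 powr (2 powr real n) < C * c powr (real n + 1)) sequentially"
    using assms by real_asymp
  then show ?thesis
  proof eventually_elim
    case (elim n)
    have "(2::real) powr (2 powr real n) = 2 ^ 2 ^ n"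
      using powr_realpow[of 2 "2 ^ n"] by (simp add: powr_realpow)
    moreover have "c powr (real n + 1) = c ^ Suc n"
      using powr_realpow[OF assms(1), of "Suc n"] by (simp add: add.commute)
    ultimately show ?case using elim by simp
  qed
qed

text \<open>Each quotient equals \<open>1 - (x - r (Suc n)) / (x - r n)\<close>. It is therefore at
  most 1, and an upper bound \<open>L\<close> on it is a lower bound \<open>1 - L\<close> on the
  ratio of successive errors.\<close>

lemma limsup_relative_step_eq_1:
  fixes r :: "nat \<Rightarrow> real"
  assumes less: "\<And>n. r n < x"
    and close: "infinite {n. x - r (Suc n) \<le> 1 / 2 ^ 2 ^ n}"
  shows "limsup (\<lambda>n. ereal ((r (Suc n) - r n) / (x - r n))) = 1"
proof (rule antisym)
  have "(r (Suc n) - r n) / (x - r n) \<le> 1" for n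
    using less[of n] less[of "Suc n"] by simp
  then show "limsup (\<lambda>n. ereal ((r (Suc n) - r n) / (x - r n))) \<le> 1"
    by (intro Limsup_bounded) (simp add: one_ereal_def)
  show "1 \<le> limsup (\<lambda>n. ereal ((r (Suc n) - r n) / (x - r n)))"
  proof (rule ccontr)
    assume "\<not> ?thesis"
    then have "limsup (\<lambda>n. ereal ((r (Suc n) - r n) / (x - r n))) < ereal 1"
      by (simp add: one_ereal_def)
    \<comment> \<open>Only \<open>1 - L > 0\<close> is needed below, so \<open>L\<close> may be
      negative.\<close>
    then obtain L where "limsup (\<lambda>n. ereal ((r (Suc n) - r n) / (x - r n))) < ereal L" "L < 1"
      using ereal_dense2 by fastforce
    then have "eventually (\<lambda>n. (r (Suc n) - r n) / (x - r n) < L) sequentially"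
      using Limsup_lessD by fastforce
    then have "eventually (\<lambda>n. (1 - L) * (x - r n) \<le> x - r (Suc n)) sequentially"
    proof eventually_elim
      case (elim n)
      then show ?case using less[of n] by (simp add: field_simps)
    qed
    then obtain C where "C > 0" and C: "eventually (\<lambda>n. C * (1 - L) ^ n \<le> x - r n) sequentially"
      using geometric_lower_bound[of "\<lambda>n. x - r n" "1 - L"] less \<open>L < 1\<close> by auto
    have "eventually (\<lambda>n. 1 / 2 ^ 2 ^ n < C * (1 - L) ^ Suc n) sequentially"
      using \<open>C > 0\<close> \<open>L < 1\<close> by (intro doubly_exponential_less_geometric) auto
    \<comment> \<open>The shift by one matches \<open>close\<close>, which bounds the error at
      \<open>Suc n\<close>.\<close>
    moreover have "eventually (\<lambda>n. C * (1 - L) ^ Suc n \<le> x - r (Suc n)) sequentially"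
      using C by (rule eventually_compose_filterlim[OF _ filterlim_Suc])
    ultimately have "eventually (\<lambda>n. \<not> x - r (Suc n) \<le> 1 / 2 ^ 2 ^ n) sequentially"
      by eventually_elim linarith
    with close show False
      by (simp add: cofinite_eq_sequentially[symmetric] eventually_cofinite)
  qed
qed

lemma infinite_close_pow2_subseq:
  fixes r :: "nat \<Rightarrow> real"
  assumes "mono r" "infinite {n. x - r n \<le> 1 / 2 ^ n}"
  shows "infinite {k. x - r (2 ^ Suc k) \<le> 1 / 2 ^ 2 ^ k}"
  unfolding infinite_nat_iff_unbounded_le
proof
  fix K :: nat
  \<comment> \<open>Starting beyond \<open>2 ^ K\<close> forces the exponent \<open>k\<close> found
    below to be at least \<open>K\<close>.\<close>
  from assms(2) obtain m where m: "m \<ge> 2 ^ K" "x - r m \<le> 1 / 2 ^ m"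
    unfolding infinite_nat_iff_unbounded_le by blast
  have "m > 0" using m(1) by (metis gr0I le_zero_eq power_eq_0_iff zero_neq_numeral)
  then obtain k where k: "2 ^ k \<le> m" "m < 2 ^ Suc k"
    using ex_power_ivl1[of 2 m] by auto
  have "(2::nat) ^ K < 2 ^ Suc k" using m(1) k(2) by linarith
  then have "K \<le> k" by (simp only: power_strict_increasing_iff)
  \<comment> \<open>Rounding \<open>m\<close> up to a power of two cannot increase the error;
    rounding the exponent \<open>m\<close> down to \<open>2 ^ k\<close> only weakens the
    bound.\<close>
  have "x - r (2 ^ Suc k) \<le> x - r m"
    using assms(1) k(2) by (simp add: mono_def)
  also note m(2)
  also have "1 / 2 ^ m \<le> 1 / (2::real) ^ 2 ^ k"
    using k(1) by (intro divide_left_mono power_increasing) auto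
  finally show "\<exists>k\<ge>K. k \<in> {k. x - r (2 ^ Suc k) \<le> 1 / 2 ^ 2 ^ k}"
    using \<open>K \<le> k\<close> by blast
qed

theorem theorem11:
  fixes x :: real
  assumes "regainingly_approximable x"
  shows "superspeedable x"
proof -
  from assms obtain q where q: "left_approximation q x"
    and close: "infinite {n. x - real_of_rat (q n) \<le> 1 / 2 ^ n}"
    unfolding regainingly_approximable_def by blast
  have sub: "left_approximation (\<lambda>n. q (2 ^ n)) x"
    using q computable_pow2 by (rule left_approximation_subseq) (simp add: strict_mono_def)
  have "mono (\<lambda>n. real_of_rat (q n))"
    using q by (simp add: left_approximation_def mono_def strict_mono_less_eq of_rat_less_eq)
  then have "infinite {n. x - real_of_rat (q (2 ^ Suc n)) \<le> 1 / 2 ^ 2 ^ n}"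
    using close by (rule infinite_close_pow2_subseq)
  then have "limsup (\<lambda>n. ereal ((real_of_rat (q (2 ^ Suc n)) - real_of_rat (q (2 ^ n)))
      / (x - real_of_rat (q (2 ^ n))))) = 1"
    using left_approximation_less[OF sub] by (rule limsup_relative_step_eq_1[rotated])
  with sub show ?thesis
    unfolding superspeedable_def by blast
qed

end
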